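(* The calculus $\mathsf{LNS}_\mathsf{KB}$ is sound and complete for modal logic $\mathsf{KB}$.
   Context: $\mathsf{KB}$ is the mono-modal logic (formulae built from atoms, $\bot$, $\to$, $\Box$, $\Diamond$) of symmetric Kripke frames; equivalently, it is obtained from tense logic $\mathsf{Kt}$ (with modalities $\Box,\Diamond,\blacksquare$ and the backwards diamond $\Diamond^{-1}$) by identifying forward and backward modalities, e.g. via the axiom $\Box A\leftrightarrow\blacksquare A$. Linear nested sequents for $\mathsf{KB}$ are given by $S := \Gamma\Rightarrow\Delta \mid \Gamma\Rightarrow\Delta\nearrow S$ with $\Gamma,\Delta$ finite multisets of formulae ($\epsilon$ for empty), interpreted via $\tau(\Gamma\Rightarrow\Delta)=\bigwedge\Gamma\to\bigvee\Delta$ and $\tau(\Gamma\Rightarrow\Delta\nearrow\mathcal{G})=\bigwedge\Gamma\to(\bigvee\Delta\lor\Box\tau(\mathcal{G}))$. The calculus $\mathsf{LNS}_\mathsf{KB}$ consists of the following rules, $\mathcal{G}$ a possibly empty context (premisses before "/", conclusion after): (id): $\mathcal{G}\nearrow\Gamma,p\Rightarrow p,\Delta$; $\bot_L$: $\mathcal{G}\nearrow\Gamma,\bot\Rightarrow\Delta$; $\mathsf{EW}$: $\mathcal{G}$ / $\mathcal{G}\nearrow\Gamma\Rightarrow\Delta$; $\to_R$: $\mathcal{G}\nearrow\Gamma,A\Rightarrow\Delta,A\to B,B$ / $\mathcal{G}\nearrow\Gamma\Rightarrow\Delta,A\to B$; $\to_L$: $\mathcal{G}\nearrow\Gamma,A\to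 B,B\Rightarrow\Delta$ and $\mathcal{G}\nearrow\Gamma,A\to B\Rightarrow\Delta,A$ / $\mathcal{G}\nearrow\Gamma,A\to B\Rightarrow\Delta$; $\Box_R$: $\mathcal{G}\nearrow\Gamma\Rightarrow\Delta,\Box A\nearrow\epsilon\Rightarrow A$ / $\mathcal{G}\nearrow\Gamma\Rightarrow\Delta,\Box A$; $\Box_L^1$: $\mathcal{G}\nearrow\Gamma,\Box A\Rightarrow\Delta\nearrow\Sigma,A\Rightarrow\Pi$ / $\mathcal{G}\nearrow\Gamma,\Box A\Rightarrow\Delta\nearrow\Sigma\Rightarrow\Pi$; $\Box_L^2$: $\mathcal{G}\nearrow\Gamma,A\Rightarrow\Delta$ / $\mathcal{G}\nearrow\Gamma\Rightarrow\Delta\nearrow\Sigma,\Box A\Rightarrow\Pi$.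
   Formalization: The diamond is read as the abbreviation ◇A = ¬□¬A rather than as a primitive connective; with a primitive ◇ the calculus, which has no rule for ◇ and only an atomic (id), would not derive the valid formula ◇p → ◇p. *)

theory Defs
  imports Main "HOL-Library.Multiset"
begin

(* Diamond is the abbreviation Not Box Not, like the other connectives below: the calculus
   has no rules for a primitive diamond, so it can only be complete with the diamond defined. *)
datatype 'p form =
    Atom 'p
  | Bot
  | Imp "'p form" "'p form"
  | Box "'p form"

abbreviation Neg :: "'p form \<Rightarrow> 'p form" where
  "Neg A \<equiv> Imp A Bot"

abbreviation Top :: "'p form" where
  "Top \<equiv> Neg Bot"

abbreviation Or :: "'p form \<Rightarrow> 'p form \<Rightarrow> 'p form" where
  "Or A B \<equiv> Imp (Neg A) B"

abbreviation And :: "'p form \<Rightarrow> 'p form \<Rightarrow> 'p form" where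
  "And A B \<equiv> Neg (Imp A (Neg B))"

abbreviation Dia :: "'p form \<Rightarrow> 'p form" where
  "Dia A \<equiv> Neg (Box (Neg A))"

primrec sat :: "('w \<times> 'w) set \<Rightarrow> ('w \<Rightarrow> 'p \<Rightarrow> bool) \<Rightarrow> 'w \<Rightarrow> 'p form \<Rightarrow> bool" where
  "sat R V w (Atom p) \<longleftrightarrow> V w p"
| "sat R V w Bot \<longleftrightarrow> False"
| "sat R V w (Imp A B) \<longleftrightarrow> (sat R V w A \<longrightarrow> sat R V w B)"
| "sat R V w (Box A) \<longleftrightarrow> (\<forall>v. (w, v) \<in> R \<longrightarrow> sat R V v A)"

lemma sat_Dia: "sat R V w (Dia A) \<longleftrightarrow> (\<exists>v. (w, v) \<in> R \<and> sat R V v A)"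
  by simp

definition symmetric_frame :: "'w set \<Rightarrow> ('w \<times> 'w) set \<Rightarrow> bool" where
  "symmetric_frame W R \<longleftrightarrow> W \<noteq> {} \<and> R \<subseteq> W \<times> W \<and> sym R"

(* HOL cannot quantify over types inside a formula, so the logic of symmetric frames takes the
   type from which worlds are drawn as a parameter; the carrier W is an arbitrary nonempty
   subset of it. A finite type only provides frames of bounded size, so the completeness direction
   needs an infinite one. The valuation outside W is irrelevant since R is a relation on W. *)
definition KB :: "'w itself \<Rightarrow> 'p form set" where
  "KB (_ :: 'w itself) =
     {A. \<forall>(W :: 'w set) R V w. symmetric_frame W R \<longrightarrow> w \<in> W \<longrightarrow> sat R V w A}"

datatype 'p sequent =
  Sequent "'p form multiset" "'p form multiset"  (infix "\<Rrightarrow>" 55)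

(* A linear nested sequent is a nonempty list of components, outermost first; a context is a
   possibly empty list. The empty list is not a linear nested sequent and is not derivable. *)
type_synonym 'p lns = "'p sequent list"

(* Conjunction and disjunction of a finite multiset, formed along an arbitrary enumeration of
   it; by the two lemmas below the choice of enumeration is immaterial. *)
definition BigAnd :: "'p form multiset \<Rightarrow> 'p form" where
  "BigAnd \<Gamma> = foldr And (SOME As. mset As = \<Gamma>) Top"

definition BigOr :: "'p form multiset \<Rightarrow> 'p form" where
  "BigOr \<Delta> = foldr Or (SOME As. mset As = \<Delta>) Bot"

lemma sat_BigAnd: "sat R V w (BigAnd \<Gamma>) \<longleftrightarrow> (\<forall>A \<in># \<Gamma>. sat R V w A)"
proof -
  have *: "sat R V w (foldr And As Top) \<longleftrightarrow> (\<forall>A \<in> set As. sat R V w A)" for As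
    by (induction As) auto
  have "mset (SOME As. mset As = \<Gamma>) = \<Gamma>"
    by (rule someI_ex) (rule ex_mset)
  then show ?thesis
    unfolding BigAnd_def * by (metis set_mset_mset)
qed

lemma sat_BigOr: "sat R V w (BigOr \<Delta>) \<longleftrightarrow> (\<exists>A \<in># \<Delta>. sat R V w A)"
proof -
  have *: "sat R V w (foldr Or As Bot) \<longleftrightarrow> (\<exists>A \<in> set As. sat R V w A)" for As
    by (induction As) auto
  have "mset (SOME As. mset As = \<Delta>) = \<Delta>"
    by (rule someI_ex) (rule ex_mset)
  then show ?thesis
    unfolding BigOr_def * by (metis set_mset_mset)
qed

(* The value on the empty list is a dummy. *)
fun tau :: "'p lns \<Rightarrow> 'p form" where
  "tau [] = Bot"
| "tau [\<Gamma> \<Rrightarrow> \<Delta>] = Imp (BigAnd \<Gamma>) (BigOr \<Delta>)"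
| "tau ((\<Gamma> \<Rrightarrow> \<Delta>) # S # G) = Imp (BigAnd \<Gamma>) (Or (BigOr \<Delta>) (Box (tau (S # G))))"

inductive LNS_KB :: "'p lns \<Rightarrow> bool" where
  id: "LNS_KB (G @ [add_mset (Atom p) \<Gamma> \<Rrightarrow> add_mset (Atom p) \<Delta>])"
| BotL: "LNS_KB (G @ [add_mset Bot \<Gamma> \<Rrightarrow> \<Delta>])"
| EW: "LNS_KB G \<Longrightarrow> LNS_KB (G @ [\<Gamma> \<Rrightarrow> \<Delta>])"
| ImpR: "LNS_KB (G @ [add_mset A \<Gamma> \<Rrightarrow> add_mset B (add_mset (Imp A B) \<Delta>)])
    \<Longrightarrow> LNS_KB (G @ [\<Gamma> \<Rrightarrow> add_mset (Imp A B) \<Delta>])"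
| ImpL: "LNS_KB (G @ [add_mset B (add_mset (Imp A B) \<Gamma>) \<Rrightarrow> \<Delta>])
    \<Longrightarrow> LNS_KB (G @ [add_mset (Imp A B) \<Gamma> \<Rrightarrow> add_mset A \<Delta>])
    \<Longrightarrow> LNS_KB (G @ [add_mset (Imp A B) \<Gamma> \<Rrightarrow> \<Delta>])"
| BoxR: "LNS_KB (G @ [\<Gamma> \<Rrightarrow> add_mset (Box A) \<Delta>, {#} \<Rrightarrow> {#A#}])
    \<Longrightarrow> LNS_KB (G @ [\<Gamma> \<Rrightarrow> add_mset (Box A) \<Delta>])"
| BoxL1: "LNS_KB (G @ [add_mset (Box A) \<Gamma> \<Rrightarrow> \<Delta>, add_mset A \<Sigma> \<Rrightarrow> \<Pi>])
    \<Longrightarrow> LNS_KB (G @ [add_mset (Box A) \<Gamma> \<Rrightarrow> \<Delta>, \<Sigma> \<Rrightarrow> \<Pi>])"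
| BoxL2: "LNS_KB (G @ [add_mset A \<Gamma> \<Rrightarrow> \<Delta>])
    \<Longrightarrow> LNS_KB (G @ [\<Gamma> \<Rrightarrow> \<Delta>, add_mset (Box A) \<Sigma> \<Rrightarrow> \<Pi>])"

lemma LNS_KB_nonempty: "LNS_KB G \<Longrightarrow> G \<noteq> []"
  by (induction rule: LNS_KB.induct) auto

end

theory Submission
  imports Defs "HOL-Library.Countable_Set"
begin

(* Completeness comes from a canonical model. Fix a finite set F of formulae closed under
   subformulae. A world is an underivable linear nested sequent over F whose last component cannot
   be enlarged inside F without making the whole derivable; accessibility is the symmetric closure of
   adding one component at the end. Formulae on the left (right) of the last component are true
   (false) at the world. The point is Box_L^2: its premiss drops the last component, so a boxed
   formula on the left of a child puts its body on the left of the parent because the parent is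
   itself maximal, and no component except the last ever has to be modified. *)

section \<open>Soundness\<close>

text \<open>From here on \<open>tau\<close> is unfolded only through its truth conditions, so the
  arbitrary enumerations behind \<open>BigAnd\<close> and \<open>BigOr\<close> never
  surface.\<close>

declare tau.simps [simp del]

lemma sat_tau_single:
  "sat R V w (tau [\<Gamma> \<Rrightarrow> \<Delta>]) \<longleftrightarrow>
    ((\<forall>A \<in># \<Gamma>. sat R V w A) \<longrightarrow> (\<exists>A \<in># \<Delta>. sat R V w A))"
  by (simp add: tau.simps sat_BigAnd sat_BigOr)

lemma sat_tau_Cons:
  "G \<noteq> [] \<Longrightarrow> sat R V w (tau ((\<Gamma> \<Rrightarrow> \<Delta>) # G)) \<longleftrightarrow>
    ((\<forall>A \<in># \<Gamma>. sat R V w A) \<longrightarrow>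
      (\<exists>A \<in># \<Delta>. sat R V w A) \<or> (\<forall>v. (w, v) \<in> R \<longrightarrow> sat R V v (tau G)))"
  by (cases G) (auto simp: tau.simps sat_BigAnd sat_BigOr)

text \<open>Rules act only at the end of a sequent. A context component wraps every premiss and the
  conclusion in the same implication with a box, and an inference that is sound at every world
  survives this wrapping. \<open>P\<close> collects the ends of the premisses, so axioms take
  \<open>P = {}\<close>; nonempty ends ensure that each context component contributes its
  box.\<close>

lemma sat_tau_context:
  assumes "[] \<notin> P" and "H \<noteq> []"
    and "\<And>v. \<forall>K \<in> P. sat R V v (tau K) \<Longrightarrow> sat R V v (tau H)"
    and "\<forall>K \<in> P. sat R V w (tau (G @ K))"
  shows "sat R V w (tau (G @ H))"
  using assms(4)
proof (induction G arbitrary: w)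
  case Nil
  then show ?case using assms(3) by simp
next
  case (Cons S G)
  obtain \<Gamma> \<Delta> where S: "S = (\<Gamma> \<Rrightarrow> \<Delta>)" by (cases S)
  have "(\<forall>A \<in># \<Gamma>. sat R V w A) \<longrightarrow>
      (\<exists>A \<in># \<Delta>. sat R V w A) \<or> (\<forall>v. (w, v) \<in> R \<longrightarrow> sat R V v (tau (G @ K)))"
    if "K \<in> P" for K
  proof -
    have "G @ K \<noteq> []" using that assms(1) by auto
    then show ?thesis using Cons.prems that sat_tau_Cons[of "G @ K" R V w \<Gamma> \<Delta>] by (simp add: S)
  qed
  then show ?case
    using Cons.IH assms(2) sat_tau_Cons[of "G @ H" R V w \<Gamma> \<Delta>] unfolding S by auto
qed

lemma LNS_KB_sound:
  assumes "sym R" and "LNS_KB G"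
  shows "sat R V w (tau G)"
  using assms(2)
proof (induction arbitrary: w rule: LNS_KB.induct)
  case (id G p \<Gamma> \<Delta>)
  show ?case by (rule sat_tau_context[of "{}"]) (auto simp: sat_tau_single)
next
  case (BotL G \<Gamma> \<Delta>)
  show ?case by (rule sat_tau_context[of "{}"]) (auto simp: sat_tau_single)
next
  case (EW G \<Gamma> \<Delta>)
  \<comment> \<open>The last component of the premiss gains a boxed disjunct in the conclusion, so
    it belongs to the active part and only \<open>G'\<close> is context.\<close>
  obtain G' S where G: "G = G' @ [S]"
    using EW.hyps LNS_KB_nonempty by (metis rev_exhaust)
  obtain \<Gamma>' \<Delta>' where S: "S = (\<Gamma>' \<Rrightarrow> \<Delta>')" by (cases S)
  have "sat R V w (tau (G' @ [S, \<Gamma> \<Rrightarrow> \<Delta>]))"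
    by (rule sat_tau_context[of "{[S]}"])
      (use EW.IH in \<open>auto simp: G S sat_tau_single sat_tau_Cons\<close>)
  then show ?case by (simp add: G)
next
  case (ImpR G A \<Gamma> B \<Delta>)
  show ?case
    by (rule sat_tau_context[of "{[add_mset A \<Gamma> \<Rrightarrow> add_mset B (add_mset (Imp A B) \<Delta>)]}"])
      (use ImpR.IH in \<open>auto simp: sat_tau_single\<close>)
next
  case (ImpL G B A \<Gamma> \<Delta>)
  show ?case
    by (rule sat_tau_context[of "{[add_mset B (add_mset (Imp A B) \<Gamma>) \<Rrightarrow> \<Delta>],
          [add_mset (Imp A B) \<Gamma> \<Rrightarrow> add_mset A \<Delta>]}"])
      (use ImpL.IH in \<open>auto simp: sat_tau_single\<close>)
next
  case (BoxR G \<Gamma> A \<Delta>)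
  show ?case
    by (rule sat_tau_context[of "{[\<Gamma> \<Rrightarrow> add_mset (Box A) \<Delta>, {#} \<Rrightarrow> {#A#}]}"])
      (use BoxR.IH in \<open>auto simp: sat_tau_single sat_tau_Cons\<close>)
next
  case (BoxL1 G A \<Gamma> \<Delta> \<Sigma> \<Pi>)
  show ?case
    by (rule sat_tau_context[of "{[add_mset (Box A) \<Gamma> \<Rrightarrow> \<Delta>, add_mset A \<Sigma> \<Rrightarrow> \<Pi>]}"])
      (use BoxL1.IH in \<open>auto simp: sat_tau_single sat_tau_Cons\<close>)
next
  case (BoxL2 G A \<Gamma> \<Delta> \<Sigma> \<Pi>)
  \<comment> \<open>Symmetry enters here: if \<open>Box A\<close> holds at a successor,
    \<open>A\<close> holds back at the current world, and the premiss then makes some formula of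
    \<open>\<Delta>\<close> true.\<close>
  show ?case
    by (rule sat_tau_context[of "{[add_mset A \<Gamma> \<Rrightarrow> \<Delta>]}"])
      (use BoxL2.IH \<open>sym R\<close> in \<open>auto simp: sat_tau_single sat_tau_Cons dest: symD\<close>)
qed

section \<open>The canonical model\<close>

primrec subformulas :: "'p form \<Rightarrow> 'p form set" where
  "subformulas (Atom p) = {Atom p}"
| "subformulas Bot = {Bot}"
| "subformulas (Imp A B) = insert (Imp A B) (subformulas A \<union> subformulas B)"
| "subformulas (Box A) = insert (Box A) (subformulas A)"

definition subformula_closed :: "'p form set \<Rightarrow> bool" where
  "subformula_closed F \<longleftrightarrow>
    (\<forall>A B. Imp A B \<in> F \<longrightarrow> A \<in> F \<and> B \<in> F) \<and> (\<forall>A. Box A \<in> F \<longrightarrow> A \<in> F)"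

lemma subformula_closed_Box: "subformula_closed F \<Longrightarrow> Box A \<in> F \<Longrightarrow> A \<in> F"
  and subformula_closed_Imp: "subformula_closed F \<Longrightarrow> Imp A B \<in> F \<Longrightarrow> A \<in> F \<and> B \<in> F"
  unfolding subformula_closed_def by blast+

lemma finite_subformulas: "finite (subformulas A)"
  by (induction A) auto

lemma subformulas_refl: "A \<in> subformulas A"
  by (cases A) auto

lemma subformulas_trans: "B \<in> subformulas A \<Longrightarrow> subformulas B \<subseteq> subformulas A"
  by (induction A) auto

lemma subformula_closed_subformulas: "subformula_closed (subformulas A)"
  unfolding subformula_closed_def
  using subformulas_trans subformulas_refl by (metis UnCI insertI2 subformulas.simps(3,4) subsetD)

definition sequents_over :: "'p form set \<Rightarrow> 'p sequent set" where
  "sequents_over F = {\<Gamma> \<Rrightarrow> \<Delta> | \<Gamma> \<Delta>. set_mset \<Gamma> \<subseteq> F \<and> set_mset \<Delta> \<subseteq> F}"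

text \<open>Multiplicities are unbounded, so a finite \<open>F\<close> yields countability rather
  than finiteness. This suffices to embed the canonical frame into any infinite type.\<close>

lemma countable_sequents_over:
  assumes "finite F"
  shows "countable (sequents_over F)"
proof -
  have "sequents_over F \<subseteq> (\<lambda>(As, Bs). mset As \<Rrightarrow> mset Bs) ` (lists F \<times> lists F)"
  proof
    fix S assume "S \<in> sequents_over F"
    then obtain \<Gamma> \<Delta> where S: "S = (\<Gamma> \<Rrightarrow> \<Delta>)" "set_mset \<Gamma> \<subseteq> F" "set_mset \<Delta> \<subseteq> F"
      by (auto simp: sequents_over_def)
    obtain As Bs where "mset As = \<Gamma>" "mset Bs = \<Delta>" by (metis ex_mset)
    with S show "S \<in> (\<lambda>(As, Bs). mset As \<Rrightarrow> mset Bs) ` (lists F \<times> lists F)"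
      by (intro image_eqI[of _ _ "(As, Bs)"]) auto
  qed
  moreover have "countable (lists F \<times> lists F)"
    using assms by (simp add: countable_finite)
  ultimately show ?thesis by (meson countable_image countable_subset)
qed

(* Extensions by several formulae at once are needed for ImpR, whose premiss adds A on the left
   and B on the right simultaneously. *)
definition maximal :: "'p form set \<Rightarrow> 'p lns \<Rightarrow> 'p form multiset \<Rightarrow> 'p form multiset \<Rightarrow> bool" where
  "maximal F G \<Gamma> \<Delta> \<longleftrightarrow> \<not> LNS_KB (G @ [\<Gamma> \<Rrightarrow> \<Delta>]) \<and>
    (\<forall>\<Gamma>' \<Delta>'. set_mset \<Gamma> \<subseteq> set_mset \<Gamma>' \<longrightarrow> set_mset \<Delta> \<subseteq> set_mset \<Delta>' \<longrightarrow>
      set_mset \<Gamma>' \<subseteq> F \<longrightarrow> set_mset \<Delta>' \<subseteq> F \<longrightarrow> \<not> LNS_KB (G @ [\<Gamma>' \<Rrightarrow> \<Delta>']) \<longrightarrow>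
      set_mset \<Gamma>' = set_mset \<Gamma> \<and> set_mset \<Delta>' = set_mset \<Delta>)"

lemma maximalD:
  assumes "maximal F G \<Gamma> \<Delta>" and "\<not> LNS_KB (G @ [\<Gamma>' \<Rrightarrow> \<Delta>'])"
    and "set_mset \<Gamma> \<subseteq> set_mset \<Gamma>'" "set_mset \<Delta> \<subseteq> set_mset \<Delta>'"
    and "set_mset \<Gamma>' \<subseteq> F" "set_mset \<Delta>' \<subseteq> F"
  shows "set_mset \<Gamma>' = set_mset \<Gamma>" "set_mset \<Delta>' = set_mset \<Delta>"
  using assms unfolding maximal_def by blast+

text \<open>Every proper extension lowers the number of formulae of \<open>F\<close> missing from
  the two sides. The measure works because maximality compares sets of members and ignores
  multiplicities.\<close>

lemma maximal_extension:
  assumes "finite F"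
    and "set_mset \<Gamma> \<subseteq> F" "set_mset \<Delta> \<subseteq> F" "\<not> LNS_KB (G @ [\<Gamma> \<Rrightarrow> \<Delta>])"
  shows "\<exists>\<Gamma>' \<Delta>'. set_mset \<Gamma> \<subseteq> set_mset \<Gamma>' \<and> set_mset \<Delta> \<subseteq> set_mset \<Delta>' \<and>
    set_mset \<Gamma>' \<subseteq> F \<and> set_mset \<Delta>' \<subseteq> F \<and> maximal F G \<Gamma>' \<Delta>'"
  using assms(2-4)
proof (induction "card (F - set_mset \<Gamma>) + card (F - set_mset \<Delta>)" arbitrary: \<Gamma> \<Delta> rule: less_induct)
  case less
  show ?case
  proof (cases "maximal F G \<Gamma> \<Delta>")
    case True
    then show ?thesis using less.prems by blast
  next
    case False
    then obtain \<Gamma>' \<Delta>' where ext: "set_mset \<Gamma> \<subseteq> set_mset \<Gamma>'" "set_mset \<Delta> \<subseteq> set_mset \<Delta>'"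
        "set_mset \<Gamma>' \<subseteq> F" "set_mset \<Delta>' \<subseteq> F" "\<not> LNS_KB (G @ [\<Gamma>' \<Rrightarrow> \<Delta>'])"
      and ne: "set_mset \<Gamma>' \<noteq> set_mset \<Gamma> \<or> set_mset \<Delta>' \<noteq> set_mset \<Delta>"
      using less.prems unfolding maximal_def by blast
    have le: "card (F - set_mset \<Gamma>') \<le> card (F - set_mset \<Gamma>)"
      "card (F - set_mset \<Delta>') \<le> card (F - set_mset \<Delta>)"
      using ext \<open>finite F\<close> by (auto intro!: card_mono)
    have "card (F - set_mset \<Gamma>') < card (F - set_mset \<Gamma>) \<or>
      card (F - set_mset \<Delta>') < card (F - set_mset \<Delta>)"
      using ne
    proof
      assume "set_mset \<Gamma>' \<noteq> set_mset \<Gamma>"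
      then have "F - set_mset \<Gamma>' \<subset> F - set_mset \<Gamma>" using ext by blast
      then show ?thesis using \<open>finite F\<close> by (simp add: psubset_card_mono)
    next
      assume "set_mset \<Delta>' \<noteq> set_mset \<Delta>"
      then have "F - set_mset \<Delta>' \<subset> F - set_mset \<Delta>" using ext by blast
      then show ?thesis using \<open>finite F\<close> by (simp add: psubset_card_mono)
    qed
    then have "card (F - set_mset \<Gamma>') + card (F - set_mset \<Delta>') <
      card (F - set_mset \<Gamma>) + card (F - set_mset \<Delta>)" using le by linarith
    from less.hyps[OF this ext(3-5)] show ?thesis using ext(1,2) by (meson subset_trans)
  qed
qed

section \<open>Canonical frame and valuation\<close>

definition worlds :: "'p form set \<Rightarrow> 'p lns set" where
  "worlds F = {G @ [\<Gamma> \<Rrightarrow> \<Delta>] | G \<Gamma> \<Delta>. G @ [\<Gamma> \<Rrightarrow> \<Delta>] \<in> lists (sequents_over F) \<and> maximal F G \<Gamma> \<Delta>}"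

definition accessible :: "'p form set \<Rightarrow> ('p lns \<times> 'p lns) set" where
  "accessible F = {(G, H) \<in> worlds F \<times> worlds F. \<exists>S. H = G @ [S] \<or> G = H @ [S]}"

primrec antecedent :: "'p sequent \<Rightarrow> 'p form multiset" where
  "antecedent (\<Gamma> \<Rrightarrow> \<Delta>) = \<Gamma>"

definition valuation :: "'p lns \<Rightarrow> 'p \<Rightarrow> bool" where
  "valuation G p \<longleftrightarrow> Atom p \<in># antecedent (last G)"

lemma in_worlds_iff:
  "G @ [\<Gamma> \<Rrightarrow> \<Delta>] \<in> worlds F \<longleftrightarrow>
    G \<in> lists (sequents_over F) \<and> set_mset \<Gamma> \<subseteq> F \<and> set_mset \<Delta> \<subseteq> F \<and> maximal F G \<Gamma> \<Delta>"
  by (auto simp: worlds_def sequents_over_def)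

lemma accessible_subset: "accessible F \<subseteq> worlds F \<times> worlds F"
  unfolding accessible_def by blast

lemma sym_accessible: "sym (accessible F)"
  unfolding accessible_def by (rule symI) blast

lemma worlds_cases:
  assumes "H \<in> worlds F"
  obtains G \<Gamma> \<Delta> where "H = G @ [\<Gamma> \<Rrightarrow> \<Delta>]"
  using assms by (auto simp: worlds_def)

text \<open>Adding \<open>A\<close> on the left of the target keeps it underivable, by
  \<open>BoxL1\<close> if the target is the child and by \<open>BoxL2\<close> if it is the parent.
  Maximality of the target then says that \<open>A\<close> was already there.\<close>

lemma accessible_Box:
  assumes F: "subformula_closed F"
    and acc: "(G @ [\<Gamma> \<Rrightarrow> \<Delta>], H @ [\<Sigma> \<Rrightarrow> \<Pi>]) \<in> accessible F"
    and Box: "Box A \<in># \<Gamma>"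
  shows "A \<in># \<Sigma>"
proof -
  have G: "G @ [\<Gamma> \<Rrightarrow> \<Delta>] \<in> worlds F" and H: "H @ [\<Sigma> \<Rrightarrow> \<Pi>] \<in> worlds F"
    using acc by (auto simp: accessible_def)
  obtain \<Gamma>' where \<Gamma>: "\<Gamma> = add_mset (Box A) \<Gamma>'" using Box by (meson mset_add)
  have "A \<in> F" using G Box subformula_closed_Box[OF F] by (auto simp: in_worlds_iff)
  have max: "maximal F H \<Sigma> \<Pi>" using H by (simp add: in_worlds_iff)
  have und: "\<not> LNS_KB (G @ [\<Gamma> \<Rrightarrow> \<Delta>])" "\<not> LNS_KB (H @ [\<Sigma> \<Rrightarrow> \<Pi>])"
    using G H by (auto simp: in_worlds_iff maximal_def)
  from acc consider "H = G @ [\<Gamma> \<Rrightarrow> \<Delta>]" | "G = H @ [\<Sigma> \<Rrightarrow> \<Pi>]"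
    by (auto simp: accessible_def)
  then have "\<not> LNS_KB (H @ [add_mset A \<Sigma> \<Rrightarrow> \<Pi>])"
  proof cases
    case 1
    then show ?thesis using und(2) BoxL1[of G A \<Gamma>' \<Delta> \<Sigma> \<Pi>] by (auto simp: \<Gamma>)
  next
    case 2
    then show ?thesis using und(1) BoxL2[of H A \<Sigma> \<Pi> \<Gamma>' \<Delta>] by (auto simp: \<Gamma>)
  qed
  then show ?thesis using maximalD(1)[OF max] H \<open>A \<in> F\<close> by (force simp: in_worlds_iff)
qed

text \<open>By \<open>BoxR\<close>, appending a component with only \<open>A\<close> on the right
  preserves underivability. Maximising that new component leaves the parent unchanged, so the result
  is a child of the given world.\<close>

lemma accessible_Box_witness:
  assumes "finite F" and F: "subformula_closed F"
    and G: "G @ [\<Gamma> \<Rrightarrow> \<Delta>] \<in> worlds F" and Box: "Box A \<in># \<Delta>"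
  obtains H \<Sigma> \<Pi> where "(G @ [\<Gamma> \<Rrightarrow> \<Delta>], H @ [\<Sigma> \<Rrightarrow> \<Pi>]) \<in> accessible F" "A \<in># \<Pi>"
proof -
  let ?G = "G @ [\<Gamma> \<Rrightarrow> \<Delta>]"
  obtain \<Delta>' where \<Delta>: "\<Delta> = add_mset (Box A) \<Delta>'" using Box by (meson mset_add)
  have "A \<in> F" using G Box subformula_closed_Box[OF F] by (auto simp: in_worlds_iff)
  have "\<not> LNS_KB (?G @ [{#} \<Rrightarrow> {#A#}])"
    using G BoxR[of G \<Gamma> A \<Delta>'] by (auto simp: \<Delta> in_worlds_iff maximal_def)
  then obtain \<Sigma> \<Pi> where "A \<in># \<Pi>" "set_mset \<Sigma> \<subseteq> F" "set_mset \<Pi> \<subseteq> F" "maximal F ?G \<Sigma> \<Pi>"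
    using maximal_extension[of F "{#}" "{#A#}" ?G] \<open>finite F\<close> \<open>A \<in> F\<close> by auto
  moreover from this G have "?G @ [\<Sigma> \<Rrightarrow> \<Pi>] \<in> worlds F"
    unfolding in_worlds_iff by (auto simp: sequents_over_def)
  ultimately show ?thesis
    using that[of ?G \<Sigma> \<Pi>] G by (auto simp: accessible_def)
qed

text \<open>With no cut rule at hand, it is not claimed that each formula of \<open>F\<close> lies
  on one of the two sides; hence two implications instead of an equivalence. They are proved
  together because \<open>Imp\<close> moves its first argument to the opposite side.\<close>

lemma truth_lemma:
  assumes "finite F" and F: "subformula_closed F"
    and "G @ [\<Gamma> \<Rrightarrow> \<Delta>] \<in> worlds F"
  shows "(A \<in># \<Gamma> \<longrightarrow> sat (accessible F) valuation (G @ [\<Gamma> \<Rrightarrow> \<Delta>]) A) \<and>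
    (A \<in># \<Delta> \<longrightarrow> \<not> sat (accessible F) valuation (G @ [\<Gamma> \<Rrightarrow> \<Delta>]) A)"
  using assms(3)
proof (induction A arbitrary: G \<Gamma> \<Delta>)
  case (Atom p)
  have "\<not> LNS_KB (G @ [\<Gamma> \<Rrightarrow> \<Delta>])" using Atom by (simp add: in_worlds_iff maximal_def)
  \<comment> \<open>The valuation reads the left side only, so atoms on the right are false thanks
    to \<open>id\<close>.\<close>
  then have "\<not> (Atom p \<in># \<Gamma> \<and> Atom p \<in># \<Delta>)" by (metis LNS_KB.id mset_add)
  then show ?case by (auto simp: valuation_def)
next
  case Bot
  have "\<not> LNS_KB (G @ [\<Gamma> \<Rrightarrow> \<Delta>])" using Bot by (simp add: in_worlds_iff maximal_def)
  then have "Bot \<notin># \<Gamma>" by (metis BotL mset_add)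
  then show ?case by simp
next
  case (Imp A B)
  have max: "maximal F G \<Gamma> \<Delta>" and und: "\<not> LNS_KB (G @ [\<Gamma> \<Rrightarrow> \<Delta>])"
    and sub: "set_mset \<Gamma> \<subseteq> F" "set_mset \<Delta> \<subseteq> F"
    using Imp.prems by (auto simp: in_worlds_iff maximal_def)
  \<comment> \<open>\<open>ImpL\<close> repeats its principal formula in both premisses, so each
    premiss extends the same component and maximality applies to whichever is underivable.\<close>
  have left: "B \<in># \<Gamma> \<or> A \<in># \<Delta>" if I: "Imp A B \<in># \<Gamma>"
  proof -
    have "A \<in> F" "B \<in> F" using I sub subformula_closed_Imp[OF F] by blast+
    moreover obtain \<Gamma>' where "\<Gamma> = add_mset (Imp A B) \<Gamma>'" using I by (meson mset_add)
    ultimately have "\<not> LNS_KB (G @ [add_mset B \<Gamma> \<Rrightarrow> \<Delta>]) \<or> \<not> LNS_KB (G @ [\<Gamma> \<Rrightarrow> add_mset A \<Delta>])"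
      using und ImpL by blast
    then show ?thesis
      using maximalD(1)[OF max, of "add_mset B \<Gamma>" \<Delta>] maximalD(2)[OF max, of \<Gamma> "add_mset A \<Delta>"]
        sub \<open>A \<in> F\<close> \<open>B \<in> F\<close> by auto
  qed
  have right: "A \<in># \<Gamma> \<and> B \<in># \<Delta>" if I: "Imp A B \<in># \<Delta>"
  proof -
    have AB: "A \<in> F" "B \<in> F" using I sub subformula_closed_Imp[OF F] by blast+
    obtain \<Delta>' where \<Delta>: "\<Delta> = add_mset (Imp A B) \<Delta>'" using I by (meson mset_add)
    have und': "\<not> LNS_KB (G @ [add_mset A \<Gamma> \<Rrightarrow> add_mset B \<Delta>])"
      using und ImpR[of G A \<Gamma> B \<Delta>'] by (auto simp: \<Delta>)
    then show ?thesis using maximalD[OF max und'] sub AB by auto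
  qed
  show ?case using left right Imp.IH[OF Imp.prems] by auto
next
  case (Box A)
  have "sat (accessible F) valuation H A" if "Box A \<in># \<Gamma>" "(G @ [\<Gamma> \<Rrightarrow> \<Delta>], H) \<in> accessible F" for H
  proof -
    have H: "H \<in> worlds F" using that(2) by (simp add: accessible_def)
    then obtain G' \<Sigma> \<Pi> where "H = G' @ [\<Sigma> \<Rrightarrow> \<Pi>]" by (rule worlds_cases)
    then show ?thesis using Box.IH H accessible_Box[OF F] that by blast
  qed
  moreover have "\<not> sat (accessible F) valuation (G @ [\<Gamma> \<Rrightarrow> \<Delta>]) (Box A)" if rt: "Box A \<in># \<Delta>"
  proof -
    obtain H \<Sigma> \<Pi> where H: "(G @ [\<Gamma> \<Rrightarrow> \<Delta>], H @ [\<Sigma> \<Rrightarrow> \<Pi>]) \<in> accessible F" "A \<in># \<Pi>"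
      using accessible_Box_witness[OF assms(1) F Box.prems rt] .
    then have "H @ [\<Sigma> \<Rrightarrow> \<Pi>] \<in> worlds F" by (simp add: accessible_def)
    then show ?thesis using Box.IH H by auto
  qed
  ultimately show ?case by auto
qed

section \<open>Transfer to an arbitrary infinite type\<close>

text \<open>On \<open>W\<close> the map \<open>f\<close> is an isomorphism onto the image frame. As
  \<open>R\<close> stays inside \<open>W\<close>, evaluation only meets points where
  \<open>inv_into W f\<close> undoes \<open>f\<close>.\<close>

lemma sat_map_prod:
  assumes "inj_on f W" and "R \<subseteq> W \<times> W" and "w \<in> W"
  shows "sat (map_prod f f ` R) (\<lambda>y. V (inv_into W f y)) (f w) A \<longleftrightarrow> sat R V w A"
  using assms(3)
proof (induction A arbitrary: w)
  case (Box A)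
  have "(f w, y) \<in> map_prod f f ` R \<longleftrightarrow> (\<exists>v. (w, v) \<in> R \<and> y = f v)" for y
  proof
    assume "(f w, y) \<in> map_prod f f ` R"
    then obtain u v where uv: "(u, v) \<in> R" "f w = f u" "y = f v" by auto
    moreover have "w = u" using assms(1,2) Box.prems uv by (blast dest: inj_onD)
    ultimately show "\<exists>v. (w, v) \<in> R \<and> y = f v" by blast
  qed force
  moreover have "v \<in> W" if "(w, v) \<in> R" for v using assms(2) that by blast
  ultimately show ?case using Box.IH by (simp del: image_iff) blast
qed (use assms(1) in auto)

text \<open>Membership in \<open>KB\<close> speaks only of frames inside \<open>'w\<close>, whereas
  canonical worlds are lists of sequents. Numbering \<open>W\<close> and injecting the naturals into
  \<open>'w\<close> gives an isomorphic copy of the frame there.\<close>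

lemma KB_countable_frame:
  assumes "infinite (UNIV :: 'w set)" and "A \<in> KB TYPE('w)"
    and "symmetric_frame W R" "countable W" "w \<in> W"
  shows "sat R V w A"
proof -
  obtain g :: "nat \<Rightarrow> 'w" where "inj g"
    using infinite_countable_subset[OF assms(1)] by blast
  moreover have "inj_on (to_nat_on W) W" using assms(4) by (rule inj_on_to_nat_on)
  ultimately have inj: "inj_on (g \<circ> to_nat_on W) W"
    by (meson comp_inj_on inj_on_subset subset_UNIV)
  define f where "f = g \<circ> to_nat_on W"
  have R: "R \<subseteq> W \<times> W" "sym R" using assms(3) by (auto simp: symmetric_frame_def)
  have "map_prod f f ` R \<subseteq> f ` W \<times> f ` W" using R(1) by auto
  moreover have "sym (map_prod f f ` R)" using R(2) by (fastforce intro!: symI dest: symD)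
  ultimately have "symmetric_frame (f ` W) (map_prod f f ` R)"
    using assms(5) by (auto simp: symmetric_frame_def)
  then have "sat (map_prod f f ` R) (\<lambda>y. V (inv_into W f y)) (f w) A"
    using assms(2,5) unfolding KB_def by blast
  then show ?thesis by (simp only: sat_map_prod[OF inj[folded f_def] R(1) assms(5)])
qed

text \<open>If the sequent were underivable, a maximal extension of it within the subformulae of
  \<open>A\<close> would be a one-component world with \<open>A\<close> on the right. The truth
  lemma refutes \<open>A\<close> there, against its validity on the countable canonical
  frame.\<close>

lemma LNS_KB_complete:
  fixes A :: "'p form"
  assumes "infinite (UNIV :: 'w set)" and "A \<in> KB TYPE('w)"
  shows "LNS_KB [{#} \<Rrightarrow> {#A#}]"
proof (rule ccontr)
  assume und: "\<not> LNS_KB [{#} \<Rrightarrow> {#A#}]"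
  define F where "F = subformulas A"
  have fin: "finite F" and F: "subformula_closed F" and "A \<in> F"
    by (simp_all add: F_def finite_subformulas subformula_closed_subformulas subformulas_refl)
  \<comment> \<open>The empty prefix is written out so that the world has the shape that
    \<open>in_worlds_iff\<close> and \<open>truth_lemma\<close> expect.\<close>
  then obtain \<Gamma> \<Delta> where A: "A \<in># \<Delta>" and world: "[] @ [\<Gamma> \<Rrightarrow> \<Delta>] \<in> worlds F"
    using maximal_extension[of F "{#}" "{#A#}" "[]"] und unfolding in_worlds_iff by auto
  have "countable (worlds F)"
    by (rule countable_subset[OF _ countable_lists[OF countable_sequents_over[OF fin]]])
      (auto simp: worlds_def)
  moreover have "symmetric_frame (worlds F) (accessible F)"
    using world accessible_subset sym_accessible unfolding symmetric_frame_def by blast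
  ultimately have "sat (accessible F) valuation ([] @ [\<Gamma> \<Rrightarrow> \<Delta>]) A"
    using KB_countable_frame[OF assms _ _ world] by simp
  then show False
    using truth_lemma[OF fin F world, of A] A by simp
qed

theorem theorem21:
  shows "(\<forall>G :: 'p lns. LNS_KB G \<longrightarrow> tau G \<in> KB TYPE('w)) \<and>
    (infinite (UNIV :: 'w set) \<longrightarrow>
      (\<forall>A :: 'p form. A \<in> KB TYPE('w) \<longrightarrow> LNS_KB [{#} \<Rrightarrow> {#A#}]))"
proof (intro conjI impI allI)
  show "tau G \<in> KB TYPE('w)" if "LNS_KB G" for G :: "'p lns"
    by (auto simp: KB_def symmetric_frame_def intro: LNS_KB_sound[OF _ that])
qed (rule LNS_KB_complete)

end
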